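(* For every integer $n\geq 3$, $ir_b(C_n)=\gamma_b(C_n)=\left\lceil\frac{n}{3}\right\rceil$, where $C_n$ is the cycle of order $n$.
   Context: For a graph $G=(V,E)$, a broadcast is a function $f:V\to\{0,\dots,\operatorname{diam}(G)\}$ with $f(v)\le e_G(v)$ (eccentricity) for all $v$. Let $V^+_f=\{v: f(v)>0\}$ and $H_f(u)=\{v\in V^+_f: d_G(u,v)\le f(v)\}$. For $v\in V^+_f$, $PN_f(v)=\{u\in V: H_f(u)=\{v\}\}$, and $PB_f(v)$ is $\{v\}$ if $f(v)=1$ and $PN_f(v)=\{v\}$, and otherwise $PB_f(v)=\{u\in PN_f(v): d_G(u,v)=f(v)\}$. The cost is $\sigma(f)=\sum_v f(v)$. $f$ is dominating if $|H_f(u)|\ge1$ for all $u$; $\gamma_b(G)$ is the minimum cost of a dominating broadcast. $f$ is irredundant if $PB_f(v)\ne\emptyset$ for every $v\in V^+_f$; it is maximal irredundant if no irredundant broadcast $g\ne f$ satisfies $g\ge f$ pointwise; $ir_b(G)$ is the minimum cost of a maximal irredundant broadcast. *)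

theory Defs
  imports Complex_Main "HOL-Library.FuncSet" "Graph_Theory.Pair_Digraph"
begin

text \<open>
  Following \<^theory>\<open>Graph_Theory.Pair_Digraph\<close>, an undirected graph is a symmetric digraph: the
  simple graphs are the instances of \<^locale>\<open>pair_graph\<close>. The notions below are intended for
  finite connected nonempty graphs; on others the \<open>LEAST\<close> and \<^const>\<open>Max\<close> may be unspecified.
\<close>

definition graph_dist :: "'a pair_pre_digraph \<Rightarrow> 'a \<Rightarrow> 'a \<Rightarrow> nat" where
  "graph_dist G u v = (LEAST k. \<exists>p. pre_digraph.awalk (with_proj G) u p v \<and> length p = k)"

definition eccentricity :: "'a pair_pre_digraph \<Rightarrow> 'a \<Rightarrow> nat" where
  "eccentricity G v = Max (graph_dist G v ` pverts G)"

definition graph_diam :: "'a pair_pre_digraph \<Rightarrow> nat" where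
  "graph_diam G = Max (eccentricity G ` pverts G)"

text \<open>
  A broadcast is taken to be extensional, that is, \<^const>\<open>undefined\<close> outside the vertex set, so that
  equality of broadcasts is equality as functions on the vertex set.
\<close>

definition broadcast :: "'a pair_pre_digraph \<Rightarrow> ('a \<Rightarrow> nat) \<Rightarrow> bool" where
  "broadcast G f \<longleftrightarrow>
     f \<in> pverts G \<rightarrow>\<^sub>E {0..graph_diam G} \<and> (\<forall>v\<in>pverts G. f v \<le> eccentricity G v)"

definition broadcasting_verts :: "'a pair_pre_digraph \<Rightarrow> ('a \<Rightarrow> nat) \<Rightarrow> 'a set" where
  "broadcasting_verts G f = {v \<in> pverts G. f v > 0}"

definition heard :: "'a pair_pre_digraph \<Rightarrow> ('a \<Rightarrow> nat) \<Rightarrow> 'a \<Rightarrow> 'a set" where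
  "heard G f u = {v \<in> broadcasting_verts G f. graph_dist G u v \<le> f v}"

definition private_nbhd :: "'a pair_pre_digraph \<Rightarrow> ('a \<Rightarrow> nat) \<Rightarrow> 'a \<Rightarrow> 'a set" where
  "private_nbhd G f v = {u \<in> pverts G. heard G f u = {v}}"

definition private_boundary :: "'a pair_pre_digraph \<Rightarrow> ('a \<Rightarrow> nat) \<Rightarrow> 'a \<Rightarrow> 'a set" where
  "private_boundary G f v =
     (if f v = 1 \<and> private_nbhd G f v = {v} then {v}
      else {u \<in> private_nbhd G f v. graph_dist G u v = f v})"

definition broadcast_cost :: "'a pair_pre_digraph \<Rightarrow> ('a \<Rightarrow> nat) \<Rightarrow> nat" where
  "broadcast_cost G f = (\<Sum>v\<in>pverts G. f v)"

definition dominating_broadcast :: "'a pair_pre_digraph \<Rightarrow> ('a \<Rightarrow> nat) \<Rightarrow> bool" where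
  "dominating_broadcast G f \<longleftrightarrow> broadcast G f \<and> (\<forall>u\<in>pverts G. card (heard G f u) \<ge> 1)"

definition irredundant_broadcast :: "'a pair_pre_digraph \<Rightarrow> ('a \<Rightarrow> nat) \<Rightarrow> bool" where
  "irredundant_broadcast G f \<longleftrightarrow>
     broadcast G f \<and> (\<forall>v\<in>broadcasting_verts G f. private_boundary G f v \<noteq> {})"

definition maximal_irredundant_broadcast :: "'a pair_pre_digraph \<Rightarrow> ('a \<Rightarrow> nat) \<Rightarrow> bool" where
  "maximal_irredundant_broadcast G f \<longleftrightarrow>
     irredundant_broadcast G f \<and>
     \<not> (\<exists>g. irredundant_broadcast G g \<and> g \<noteq> f \<and> (\<forall>v\<in>pverts G. g v \<ge> f v))"

text \<open>
  On \<^typ>\<open>nat\<close>, the infimum of a nonempty set is its minimum, and the infimum of the empty set is \<open>0\<close>.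
\<close>

definition broadcast_domination_number :: "'a pair_pre_digraph \<Rightarrow> nat" (\<open>\<gamma>\<^sub>b\<close>) where
  "\<gamma>\<^sub>b G = Inf {broadcast_cost G f | f. dominating_broadcast G f}"

definition broadcast_irredundance_number :: "'a pair_pre_digraph \<Rightarrow> nat" (\<open>ir\<^sub>b\<close>) where
  "ir\<^sub>b G = Inf {broadcast_cost G f | f. maximal_irredundant_broadcast G f}"

definition cycle_graph :: "nat \<Rightarrow> nat pair_pre_digraph" where
  "cycle_graph n =
     \<lparr> pverts = {0..<n},
       parcs = (\<Union>i\<in>{0..<n}. {(i, (i + 1) mod n), ((i + 1) mod n, i)}) \<rparr>"

lemma pair_graph_cycle_graph:
  assumes "n \<ge> 2"
  shows "pair_graph (cycle_graph n)"
proof -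
  have ne: "Suc i mod n \<noteq> i" if "i < n" for i
    using that assms by (cases "Suc i = n") auto
  show ?thesis
    using assms ne ne[symmetric]
    by unfold_locales
      (auto simp: cycle_graph_def symmetric_def arcs_ends_def arc_to_ends_def sym_def)
qed

end

theory Submission
  imports Defs
begin

text \<open>
  A vertex \<open>v\<close> of \<open>C\<^sub>n\<close> reaches at most \<open>2 f(v) + 1 \<le> 3 f(v)\<close> vertices, so a dominating broadcast
  costs at least \<open>n/3\<close>, and putting \<open>1\<close> on every third vertex attains the bound. In any graph, a
  dominating broadcast of minimum cost is maximal irredundant, so \<open>ir\<^sub>b \<le> \<gamma>\<^sub>b\<close>.

  For the lower bound on \<open>ir\<^sub>b\<close>, let \<open>f\<close> be maximal irredundant and let \<open>u\<close> hear nothing. Setting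
  \<open>f(u) = 1\<close> must destroy the private boundary of some \<open>v\<close>; as \<open>u\<close> then lies just beyond the reach of
  \<open>v\<close>, also raising \<open>f(v)\<close> by one must destroy the private boundary of some \<open>v'\<close>. Only the vertex
  just beyond the reach of \<open>v\<close> on the other side can be responsible, so that vertex is dominated. Hence
  \<open>v\<close> can be charged with \<open>u\<close> as well, and \<open>2 f(v) + 2 \<le> 3 f(v)\<close> unless \<open>f(v) = 1\<close>. If \<open>f(v) = 1\<close>,
  then \<open>v'\<close> is forced to be the neighbour of \<open>v\<close> opposite to \<open>u\<close> with \<open>f(v') = 1\<close>, and the pair \<open>v, v'\<close>
  pays for the six vertices around it.
\<close>

section \<open>Broadcasts on an abstract finite graph with a symmetric distance\<close>

locale metric_graph =
  fixes G :: "'a pair_pre_digraph"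
  assumes finite_verts: "finite (pverts G)"
    and dist_eq_0_iff: "\<lbrakk>u \<in> pverts G; v \<in> pverts G\<rbrakk> \<Longrightarrow> graph_dist G u v = 0 \<longleftrightarrow> u = v"
    and dist_commute: "\<lbrakk>u \<in> pverts G; v \<in> pverts G\<rbrakk> \<Longrightarrow> graph_dist G u v = graph_dist G v u"
begin

lemma dist_le_eccentricity:
  assumes "u \<in> pverts G" "v \<in> pverts G"
  shows "graph_dist G u v \<le> eccentricity G v"
  using assms finite_verts by (auto simp: eccentricity_def dist_commute[of u v] intro!: Max_ge)

lemma eccentricity_le_diam: "v \<in> pverts G \<Longrightarrow> eccentricity G v \<le> graph_diam G"
  using finite_verts by (auto simp: graph_diam_def intro!: Max_ge)

lemma broadcast_iff:
  "broadcast G f \<longleftrightarrow> f \<in> extensional (pverts G) \<and> (\<forall>v\<in>pverts G. f v \<le> eccentricity G v)"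
  unfolding broadcast_def PiE_def Pi_def using eccentricity_le_diam by (auto intro: order_trans)

lemma broadcast_upd:
  assumes "broadcast G f" "v \<in> pverts G" "k \<le> eccentricity G v"
  shows "broadcast G (f(v := k))"
  using assms unfolding broadcast_iff extensional_def by auto

text \<open>The case split in \<open>private_boundary\<close> collapses: when
  \<open>f v = 1\<close>, a private neighbour other than \<open>v\<close> is at distance exactly 1,
  and if \<open>v\<close> is the only one, the special case applies.\<close>

lemma private_boundary_nonempty_iff:
  assumes "v \<in> broadcasting_verts G f"
  shows "private_boundary G f v \<noteq> {} \<longleftrightarrow>
    (\<exists>y\<in>pverts G. heard G f y = {v} \<and> (graph_dist G y v = f v \<or> f v = 1))"
proof
  assume "private_boundary G f v \<noteq> {}"
  then show "\<exists>y\<in>pverts G. heard G f y = {v} \<and> (graph_dist G y v = f v \<or> f v = 1)"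
    unfolding private_boundary_def private_nbhd_def by (auto split: if_splits)
next
  assume "\<exists>y\<in>pverts G. heard G f y = {v} \<and> (graph_dist G y v = f v \<or> f v = 1)"
  then obtain y where y: "y \<in> pverts G" "heard G f y = {v}" "graph_dist G y v = f v \<or> f v = 1"
    by blast
  have v: "v \<in> pverts G" using assms by (simp add: broadcasting_verts_def)
  show "private_boundary G f v \<noteq> {}"
  proof (cases "f v = 1 \<and> private_nbhd G f v = {v}")
    case True
    then show ?thesis by (simp add: private_boundary_def)
  next
    case False
    have "\<exists>z\<in>private_nbhd G f v. graph_dist G z v = f v"
    proof (cases "graph_dist G y v = f v")
      case True
      then show ?thesis using y by (auto simp: private_nbhd_def)
    next
      case far: False
      with y False obtain z where z: "z \<in> private_nbhd G f v" "z \<noteq> v"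
        unfolding private_nbhd_def by blast
      then have "graph_dist G z v \<le> f v" "graph_dist G z v \<noteq> 0"
        using v dist_eq_0_iff[of z v] by (auto simp: private_nbhd_def heard_def)
      then have "graph_dist G z v = f v" using far y by linarith
      then show ?thesis using z by blast
    qed
    then show ?thesis using False by (auto simp: private_boundary_def)
  qed
qed

lemma irredundant_iff:
  "irredundant_broadcast G f \<longleftrightarrow> broadcast G f \<and> (\<forall>v\<in>broadcasting_verts G f.
     \<exists>y\<in>pverts G. heard G f y = {v} \<and> (graph_dist G y v = f v \<or> f v = 1))"
  using private_boundary_nonempty_iff unfolding irredundant_broadcast_def by blast

lemma dominating_iff:
  "dominating_broadcast G f \<longleftrightarrow> broadcast G f \<and> (\<forall>u\<in>pverts G. heard G f u \<noteq> {})"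
proof -
  have "finite (heard G f u)" for u
    using finite_verts by (simp add: heard_def broadcasting_verts_def)
  then show ?thesis
    by (auto simp: dominating_broadcast_def Suc_le_eq card_gt_0_iff)
qed

lemma heard_mono:
  assumes "\<forall>v\<in>pverts G. f v \<le> g v"
  shows "heard G f u \<subseteq> heard G g u"
  using assms unfolding heard_def broadcasting_verts_def by (auto intro: order_trans less_le_trans)

text \<open>Suppose \<open>g\<close> exceeds \<open>f\<close> at \<open>v\<close>. A witness
  \<open>y\<close> for \<open>v\<close> under \<open>g\<close> hears under \<open>f\<close> a
  nonempty subset of \<open>{v}\<close>, so \<open>f v\<close> is positive and reaches
  \<open>y\<close>; this contradicts \<open>y\<close> being at distance \<open>g v\<close>, and also
  \<open>g v = 1\<close>.\<close>

lemma dominating_irredundant_imp_maximal: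
  assumes dom: "dominating_broadcast G f" and irr: "irredundant_broadcast G f"
  shows "maximal_irredundant_broadcast G f"
proof -
  have False if g: "irredundant_broadcast G g" "g \<noteq> f" "\<forall>v\<in>pverts G. g v \<ge> f v" for g
  proof -
    \<comment> \<open>Both functions are extensional, so they must differ at a vertex.\<close>
    have "\<exists>v\<in>pverts G. g v \<noteq> f v"
      using g irr unfolding irredundant_iff broadcast_iff by (meson extensionalityI)
    then obtain v where v: "v \<in> pverts G" "g v > f v" using g(3) by fastforce
    then have "v \<in> broadcasting_verts G g" by (simp add: broadcasting_verts_def)
    then obtain y where y: "y \<in> pverts G" "heard G g y = {v}" "graph_dist G y v = g v \<or> g v = 1"
      using g(1) unfolding irredundant_iff by blast
    have "heard G f y = {v}"
      using y heard_mono[of f g y] g(3) dom unfolding dominating_iff by (metis subset_singletonD)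
    then have "graph_dist G y v \<le> f v" "f v > 0"
      by (auto simp: heard_def broadcasting_verts_def)
    then show False using v y by linarith
  qed
  then show ?thesis using irr unfolding maximal_irredundant_broadcast_def by blast
qed

text \<open>If \<open>v\<close> has empty private boundary, lowering \<open>f v\<close> by one keeps
  domination: vertices hearing only \<open>v\<close> are closer than \<open>f v\<close>, and if
  there are any, \<open>f v\<close> is at least 2, so \<open>v\<close> still broadcasts.\<close>

lemma minimum_dominating_imp_irredundant:
  assumes dom: "dominating_broadcast G f"
    and least: "\<And>g. dominating_broadcast G g \<Longrightarrow> broadcast_cost G f \<le> broadcast_cost G g"
  shows "irredundant_broadcast G f"
proof (rule ccontr)
  assume "\<not> irredundant_broadcast G f"
  then obtain v where v: "v \<in> broadcasting_verts G f"
    and none: "\<And>y. \<lbrakk>y \<in> pverts G; heard G f y = {v}\<rbrakk> \<Longrightarrow> graph_dist G y v \<noteq> f v \<and> f v \<noteq> 1"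
    using dom unfolding irredundant_iff dominating_iff by blast
  have vV: "v \<in> pverts G" "f v > 0" using v by (auto simp: broadcasting_verts_def)
  let ?g = "f(v := f v - 1)"
  have "broadcast G ?g"
    using dom vV by (intro broadcast_upd) (auto simp: dominating_iff broadcast_iff intro: order_trans)
  moreover have "heard G ?g u \<noteq> {}" if u: "u \<in> pverts G" for u
  proof (cases "heard G f u = {v}")
    case True
    then have "graph_dist G u v \<le> f v" by (auto simp: heard_def)
    then have "v \<in> heard G ?g u"
      using none[OF u True] vV by (auto simp: heard_def broadcasting_verts_def)
    then show ?thesis by blast
  next
    case False
    moreover have "heard G f u \<noteq> {}" using dom u by (simp add: dominating_iff)
    ultimately obtain w where "w \<in> heard G f u" "w \<noteq> v" by blast
    then have "w \<in> heard G ?g u" by (auto simp: heard_def broadcasting_verts_def)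
    then show ?thesis by blast
  qed
  ultimately have "dominating_broadcast G ?g" by (simp add: dominating_iff)
  then have "broadcast_cost G f \<le> broadcast_cost G ?g" by (rule least)
  moreover have "broadcast_cost G ?g < broadcast_cost G f"
    unfolding broadcast_cost_def using vV finite_verts by (intro sum_strict_mono_ex1) auto
  ultimately show False by simp
qed

text \<open>This yields \<open>ir\<^sub>b \<le> \<gamma>\<^sub>b\<close>. The broadcast
  \<open>f\<^sub>0\<close> makes the set of costs nonempty, so its infimum is attained.\<close>

lemma exists_maximal_irredundant_of_domination_cost:
  assumes "dominating_broadcast G f\<^sub>0"
  shows "\<exists>f. maximal_irredundant_broadcast G f \<and> broadcast_cost G f = \<gamma>\<^sub>b G"
proof -
  let ?S = "{broadcast_cost G f | f. dominating_broadcast G f}"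
  have "Inf ?S \<in> ?S" using assms by (intro Inf_nat_def1) blast
  then obtain f where f: "dominating_broadcast G f" "broadcast_cost G f = Inf ?S" by auto
  have "irredundant_broadcast G f"
  proof (rule minimum_dominating_imp_irredundant[OF f(1)])
    fix g assume "dominating_broadcast G g"
    then show "broadcast_cost G f \<le> broadcast_cost G g"
      unfolding f(2) by (intro cInf_lower) auto
  qed
  then show ?thesis
    using f dominating_irredundant_imp_maximal by (auto simp: broadcast_domination_number_def)
qed

text \<open>Raising \<open>f u\<close> from \<open>0\<close> to \<open>1\<close> leaves \<open>u\<close> with a private neighbour, so it must
  destroy the private boundary of some other vertex.\<close>

lemma maximal_irredundant_undominated_vertex:
  assumes max: "maximal_irredundant_broadcast G f" and u: "u \<in> pverts G" "heard G f u = {}"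
    and w: "w \<in> pverts G" "w \<noteq> u"
  shows "\<exists>v\<in>broadcasting_verts G f. \<forall>y\<in>pverts G.
    heard G f y = {v} \<and> (graph_dist G y v = f v \<or> f v = 1) \<longrightarrow> graph_dist G y u \<le> 1"
proof -
  let ?g = "f(u := 1)"
  have irr: "irredundant_broadcast G f" using max by (simp add: maximal_irredundant_broadcast_def)
  have "graph_dist G u u = 0" using u dist_eq_0_iff by simp
  with u have fu: "f u = 0" by (auto simp: heard_def broadcasting_verts_def)
  have "graph_dist G w u \<noteq> 0" using dist_eq_0_iff w u by simp
  then have "1 \<le> eccentricity G u" using dist_le_eccentricity[OF w(1) u(1)] by simp
  then have bg: "broadcast G ?g" using irr u by (intro broadcast_upd) (auto simp: irredundant_iff)
  have "?g \<noteq> f" using fu by (auto simp: fun_eq_iff)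
  moreover have "\<forall>v\<in>pverts G. ?g v \<ge> f v" using fu by auto
  ultimately have "\<not> irredundant_broadcast G ?g"
    using max unfolding maximal_irredundant_broadcast_def by blast
  then obtain v where v: "v \<in> broadcasting_verts G ?g"
    and none: "\<And>y. \<lbrakk>y \<in> pverts G; heard G ?g y = {v}; graph_dist G y v = ?g v \<or> ?g v = 1\<rbrakk> \<Longrightarrow> False"
    using bg unfolding irredundant_iff by blast
  have hg: "heard G ?g y = heard G f y \<union> (if graph_dist G y u \<le> 1 then {u} else {})" for y
    using u fu by (auto simp: heard_def broadcasting_verts_def)
  have vu: "v \<noteq> u"
    using none[of u] u hg[of u] \<open>graph_dist G u u = 0\<close> by auto
  have "v \<in> broadcasting_verts G f" using v vu by (auto simp: broadcasting_verts_def)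
  moreover have "graph_dist G y u \<le> 1"
    if "y \<in> pverts G" "heard G f y = {v}" "graph_dist G y v = f v \<or> f v = 1" for y
  proof (rule ccontr)
    assume "\<not> graph_dist G y u \<le> 1"
    then have "heard G ?g y = {v}" using hg[of y] that by simp
    then show False using none[of y] that vu by auto
  qed
  ultimately show ?thesis by blast
qed

text \<open>Raising \<open>f v\<close> by one is legal because \<open>u\<close> bounds the
  eccentricity of \<open>v\<close> from below, and it makes \<open>u\<close> a private boundary
  vertex of \<open>v\<close>. So another vertex \<open>v'\<close> loses its witness
  \<open>w\<close>, which is newly reached by \<open>v\<close> and hence at distance exactly
  \<open>f v + 1\<close>.\<close>

lemma maximal_irredundant_undominated_beyond_boundary:
  assumes max: "maximal_irredundant_broadcast G f" and u: "u \<in> pverts G" "heard G f u = {}"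
    and v: "v \<in> broadcasting_verts G f" and d: "graph_dist G u v = f v + 1"
  shows "\<exists>w\<in>pverts G. \<exists>v'. v' \<noteq> v \<and> heard G f w = {v'} \<and> (graph_dist G w v' = f v' \<or> f v' = 1) \<and>
    graph_dist G w v = f v + 1"
proof -
  let ?g = "f(v := f v + 1)"
  have irr: "irredundant_broadcast G f" using max by (simp add: maximal_irredundant_broadcast_def)
  have vV: "v \<in> pverts G" "f v > 0" using v by (auto simp: broadcasting_verts_def)
  have "f v + 1 \<le> eccentricity G v" using dist_le_eccentricity[OF u(1) vV(1)] d by simp
  then have bg: "broadcast G ?g" using irr vV by (intro broadcast_upd) (auto simp: irredundant_iff)
  have "?g \<noteq> f" by (auto simp: fun_eq_iff)
  moreover have "\<forall>v\<in>pverts G. ?g v \<ge> f v" by auto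
  ultimately have "\<not> irredundant_broadcast G ?g"
    using max unfolding maximal_irredundant_broadcast_def by blast
  then obtain v' where v': "v' \<in> broadcasting_verts G ?g"
    and none: "\<And>y. \<lbrakk>y \<in> pverts G; heard G ?g y = {v'}; graph_dist G y v' = ?g v' \<or> ?g v' = 1\<rbrakk> \<Longrightarrow> False"
    using bg unfolding irredundant_iff by blast
  have hg: "heard G ?g y = heard G f y \<union> (if graph_dist G y v \<le> f v + 1 then {v} else {})" for y
    using vV by (auto simp: heard_def broadcasting_verts_def)
  have v'v: "v' \<noteq> v" using none[of u] u hg[of u] d by auto
  have "v' \<in> broadcasting_verts G f" using v' v'v by (auto simp: broadcasting_verts_def)
  then obtain w where w: "w \<in> pverts G" "heard G f w = {v'}" "graph_dist G w v' = f v' \<or> f v' = 1"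
    using irr unfolding irredundant_iff by blast
  have "graph_dist G w v \<le> f v + 1"
  proof (rule ccontr)
    assume "\<not> graph_dist G w v \<le> f v + 1"
    then have "heard G ?g w = {v'}" using hg[of w] w by simp
    then show False using none[of w] w v'v by auto
  qed
  moreover have "\<not> graph_dist G w v \<le> f v"
    using w(2) v v'v by (auto simp: heard_def)
  ultimately show ?thesis using w v'v by (intro bexI[of _ w] exI[of _ v']) auto
qed

end

section \<open>The cycle, its integer lifts and its distance\<close>

locale cycle =
  fixes n :: nat
  assumes n_ge_3: "n \<ge> 3"
begin

abbreviation G :: "nat pair_pre_digraph" where
  "G \<equiv> cycle_graph n"

definition vert :: "int \<Rightarrow> nat" where
  "vert x = nat (x mod int n)"

lemma vert_less: "vert x < n"
  using n_ge_3 by (simp add: vert_def nat_less_iff)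

lemma pverts_cycle: "pverts G = {0..<n}"
  by (simp add: cycle_graph_def)

lemma vert_in_pverts [simp]: "vert x \<in> pverts G"
  using vert_less by (simp add: pverts_cycle)

lemma vert_of_nat: "v \<in> pverts G \<Longrightarrow> vert (int v) = v"
  by (simp add: vert_def pverts_cycle)

lemma vert_eq_iff: "vert x = vert y \<longleftrightarrow> (\<exists>j. x = y + j * int n)"
proof -
  have "vert x = vert y \<longleftrightarrow> x mod int n = y mod int n"
    using n_ge_3 by (simp add: vert_def eq_nat_nat_iff)
  also have "\<dots> \<longleftrightarrow> (\<exists>j. x = y + j * int n)"
    by (auto simp: mod_eq_dvd_iff dvd_def algebra_simps)
  finally show ?thesis .
qed

lemma vert_shift [simp]: "vert (x + j * int n) = vert x"
  by (simp add: vert_def)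

lemma int_vert: "\<exists>j. int (vert x) = x + j * int n"
  using vert_of_nat[of "vert x"] vert_eq_iff by auto

lemma Suc_vert_mod: "(vert x + 1) mod n = vert (x + 1)"
proof -
  have "int ((vert x + 1) mod n) = int (vert (x + 1))"
    using n_ge_3 by (simp add: vert_def zmod_int mod_simps add.commute)
  then show ?thesis by linarith
qed

lemma arc_iff:
  "(a, b) \<in> parcs G \<longleftrightarrow> (\<exists>x. (a = vert x \<and> b = vert (x + 1)) \<or> (a = vert (x + 1) \<and> b = vert x))"
proof
  assume "(a, b) \<in> parcs G"
  then obtain i where i: "i < n"
    "(a = i \<and> b = (i + 1) mod n) \<or> (a = (i + 1) mod n \<and> b = i)"
    by (auto simp: cycle_graph_def)
  then have "vert (int i) = i" by (simp add: vert_of_nat pverts_cycle)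
  then show "\<exists>x. (a = vert x \<and> b = vert (x + 1)) \<or> (a = vert (x + 1) \<and> b = vert x)"
    using i Suc_vert_mod[of "int i"] by metis
next
  assume "\<exists>x. (a = vert x \<and> b = vert (x + 1)) \<or> (a = vert (x + 1) \<and> b = vert x)"
  then obtain x where "(a = vert x \<and> b = vert (x + 1)) \<or> (a = vert (x + 1) \<and> b = vert x)" ..
  then show "(a, b) \<in> parcs G"
    unfolding Suc_vert_mod[symmetric] using vert_less[of x]
    by (auto simp: cycle_graph_def)
qed

abbreviation walk :: "nat \<Rightarrow> (nat \<times> nat) list \<Rightarrow> nat \<Rightarrow> bool" where
  "walk \<equiv> pre_digraph.awalk (with_proj G)"

lemma walk_Nil: "walk u [] v \<longleftrightarrow> u = v \<and> u \<in> pverts G"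
  by (auto simp: pre_digraph.awalk_def pre_digraph.cas.simps)

lemma walk_Cons:
  "walk u (e # p) v \<longleftrightarrow> e \<in> parcs G \<and> fst e = u \<and> walk (snd e) p v"
proof -
  have "e \<in> parcs G \<Longrightarrow> fst e \<in> pverts G \<and> snd e \<in> pverts G"
    using arc_iff[of "fst e" "snd e"] by auto
  then show ?thesis
    by (auto simp: pre_digraph.awalk_def pre_digraph.cas.simps)
qed

text \<open>Path lifting: each arc moves the lift by one in either direction.\<close>

lemma lift_of_walk:
  "walk (vert x) p v \<Longrightarrow> \<exists>y. v = vert y \<and> \<bar>x - y\<bar> \<le> int (length p)"
proof (induction p arbitrary: x)
  case Nil
  then show ?case by (auto simp: walk_Nil)
next
  case (Cons e p)
  then have e: "(vert x, snd e) \<in> parcs G" "walk (snd e) p v"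
    by (cases e; simp add: walk_Cons)+
  obtain x' where x': "snd e = vert x'" "\<bar>x - x'\<bar> \<le> 1"
  proof -
    from e(1) obtain z where "(vert x = vert z \<and> snd e = vert (z + 1)) \<or>
        (vert x = vert (z + 1) \<and> snd e = vert z)"
      unfolding arc_iff by blast
    then show thesis
    proof
      assume a: "vert x = vert z \<and> snd e = vert (z + 1)"
      then obtain j where "x = z + j * int n" using vert_eq_iff by blast
      moreover have "snd e = vert (z + 1 + j * int n)" using a vert_shift by metis
      ultimately show thesis by (intro that[of "z + 1 + j * int n"]) auto
    next
      assume a: "vert x = vert (z + 1) \<and> snd e = vert z"
      then obtain j where "x = z + 1 + j * int n" using vert_eq_iff by blast
      moreover have "snd e = vert (z + j * int n)" using a by simp
      ultimately show thesis by (intro that[of "z + j * int n"]) auto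
    qed
  qed
  obtain y where "v = vert y" "\<bar>x' - y\<bar> \<le> int (length p)"
    using Cons.IH e(2) x'(1) by auto
  then show ?case using x'(2) by (intro exI[of _ y]) auto
qed

lemma walk_between_lifts:
  assumes "\<bar>x - y\<bar> = int k"
  shows "\<exists>p. walk (vert x) p (vert y) \<and> length p = k"
  using assms
proof (induction k arbitrary: x)
  case 0
  then show ?case by (auto simp: walk_Nil intro!: exI[of _ "[]"])
next
  case (Suc k)
  define x' where "x' = (if x < y then x + 1 else x - 1)"
  have "\<bar>x' - y\<bar> = int k" using Suc.prems by (auto simp: x'_def)
  then obtain p where p: "walk (vert x') p (vert y)" "length p = k" using Suc.IH by blast
  have "(vert x, vert x') \<in> parcs G"
    unfolding arc_iff x'_def by (cases "x < y") (auto intro: exI[of _ x] exI[of _ "x - 1"])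
  then have "walk (vert x) ((vert x, vert x') # p) (vert y)" using p by (simp add: walk_Cons)
  then show ?case using p by (intro exI[of _ "(vert x, vert x') # p"]) auto
qed

text \<open>The distance is the least distance between lifts, with \<open>j\<close> counting turns
  around the cycle. One direction lifts a shortest walk, the other projects a segment of
  integers.\<close>

lemma dist_le_iff:
  "graph_dist G (vert x) (vert y) \<le> k \<longleftrightarrow> (\<exists>j. \<bar>x - y + j * int n\<bar> \<le> int k)"
proof
  let ?P = "\<lambda>k. \<exists>p. walk (vert x) p (vert y) \<and> length p = k"
  assume le: "graph_dist G (vert x) (vert y) \<le> k"
  have "?P (nat \<bar>x - y\<bar>)" by (rule walk_between_lifts) simp
  then have "?P (graph_dist G (vert x) (vert y))" unfolding graph_dist_def by (rule LeastI)
  then obtain p where "walk (vert x) p (vert y)" "length p \<le> k" using le by auto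
  then obtain z where z: "vert y = vert z" "\<bar>x - z\<bar> \<le> int k" using lift_of_walk by fastforce
  then obtain j where "y = z + j * int n" using vert_eq_iff by blast
  then show "\<exists>j. \<bar>x - y + j * int n\<bar> \<le> int k" using z by (intro exI[of _ j]) simp
next
  let ?P = "\<lambda>k. \<exists>p. walk (vert x) p (vert y) \<and> length p = k"
  assume "\<exists>j. \<bar>x - y + j * int n\<bar> \<le> int k"
  then obtain j where j: "\<bar>x - y + j * int n\<bar> \<le> int k" ..
  have "?P (nat \<bar>x - y + j * int n\<bar>)"
    using walk_between_lifts[of "x + j * int n" y] by (simp add: algebra_simps)
  then have "graph_dist G (vert x) (vert y) \<le> nat \<bar>x - y + j * int n\<bar>"
    unfolding graph_dist_def by (rule Least_le)
  then show "graph_dist G (vert x) (vert y) \<le> k" using j by linarith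
qed

sublocale metric_graph G
proof
  show "finite (pverts G)" by (simp add: pverts_cycle)
  fix u v assume uv: "u \<in> pverts G" "v \<in> pverts G"
  have "graph_dist G (vert x) (vert y) \<le> k \<longleftrightarrow> graph_dist G (vert y) (vert x) \<le> k" for x y k
  proof -
    have "\<bar>x - y + j * int n\<bar> = \<bar>y - x + (- j) * int n\<bar>" for j by (simp add: algebra_simps)
    then show ?thesis unfolding dist_le_iff by (metis minus_minus)
  qed
  then have "graph_dist G (vert x) (vert y) = graph_dist G (vert y) (vert x)" for x y
    by (meson order_antisym order_refl)
  then show "graph_dist G u v = graph_dist G v u" using uv by (metis vert_of_nat)
  have "graph_dist G (vert x) (vert y) \<le> 0 \<longleftrightarrow> vert x = vert y" for x y
  proof -
    have "graph_dist G (vert x) (vert y) \<le> 0 \<longleftrightarrow> (\<exists>j. y = x + j * int n)"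
      unfolding dist_le_iff by (auto simp: algebra_simps)
    also have "\<dots> \<longleftrightarrow> vert y = vert x" by (rule vert_eq_iff[symmetric])
    finally show ?thesis by metis
  qed
  then show "graph_dist G u v = 0 \<longleftrightarrow> u = v" using uv by (metis le_zero_eq vert_of_nat)
qed

text \<open>
  Vertices are lifted along the covering \<open>\<int> \<rightarrow> C\<^sub>n\<close>: the vertices reached by a lift of \<open>v\<close> form an
  honest interval of integers, so no case distinction on wrapping around is needed.
\<close>

definition hears :: "(nat \<Rightarrow> nat) \<Rightarrow> int \<Rightarrow> int set" where
  "hears f y = {x. f (vert x) > 0 \<and> \<bar>y - x\<bar> \<le> int (f (vert x))}"

lemma heard_vert: "heard G f (vert y) = vert ` hears f y"
proof (intro set_eqI iffI)
  fix v assume "v \<in> heard G f (vert y)"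
  then have v: "v \<in> pverts G" "f v > 0" "graph_dist G (vert y) v \<le> f v"
    by (auto simp: heard_def broadcasting_verts_def)
  then have "graph_dist G (vert y) (vert (int v)) \<le> f v" by (simp add: vert_of_nat)
  then obtain j where j: "\<bar>y - int v + j * int n\<bar> \<le> int (f v)" unfolding dist_le_iff by blast
  have "vert (int v + (- j) * int n) = v" unfolding vert_shift by (rule vert_of_nat[OF v(1)])
  moreover have "\<bar>y - (int v + (- j) * int n)\<bar> \<le> int (f v)" using j by (simp add: algebra_simps)
  ultimately show "v \<in> vert ` hears f y"
    unfolding hears_def using v(2) by (intro image_eqI[of _ _ "int v + (- j) * int n"]) auto
next
  fix v assume "v \<in> vert ` hears f y"
  then obtain x where x: "v = vert x" "f (vert x) > 0" "\<bar>y - x\<bar> \<le> int (f (vert x))"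
    by (auto simp: hears_def)
  then have "graph_dist G (vert y) (vert x) \<le> f v"
    unfolding dist_le_iff by (intro exI[of _ 0]) simp
  then show "v \<in> heard G f (vert y)" using x by (auto simp: heard_def broadcasting_verts_def)
qed

lemma vert_inj_near:
  assumes "vert x = vert y" "\<bar>x - y\<bar> < int n"
  shows "x = y"
proof -
  obtain j where j: "x = y + j * int n" using assms vert_eq_iff by blast
  have "j = 0"
  proof (rule ccontr)
    assume "j \<noteq> 0"
    then have "1 * int n \<le> \<bar>j\<bar> * int n" by (intro mult_right_mono) auto
    then show False using assms(2) j by (simp add: abs_mult)
  qed
  then show ?thesis using j by simp
qed

lemma near_lift:
  assumes "v \<in> pverts G" "graph_dist G v (vert y) \<le> k"
  obtains x where "v = vert x" "\<bar>x - y\<bar> \<le> int k"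
proof -
  obtain j where "\<bar>int v - y + j * int n\<bar> \<le> int k"
    using assms dist_le_iff[of "int v" y] by (auto simp: vert_of_nat)
  then show thesis
    using vert_of_nat[OF assms(1)] by (intro that[of "int v + j * int n"]) (auto simp: algebra_simps)
qed

lemma dist_le_lift_dist: "graph_dist G (vert x) (vert y) \<le> nat \<bar>x - y\<bar>"
  unfolding dist_le_iff by (intro exI[of _ 0]) simp

section \<open>Private neighbours and undominated vertices on the cycle\<close>

text \<open>The conclusion compares \<open>vert z\<close> with \<open>vert x\<close>, since
  \<open>y\<close> may hear several lifts of one vertex, as when it is antipodal to a vertex of
  value \<open>n/2\<close>.\<close>

lemma private_lift:
  assumes irr: "irredundant_broadcast G f" and pos: "f (vert x) > 0"
  obtains y where "\<bar>y - x\<bar> \<le> int (f (vert x))" "\<And>z. z \<in> hears f y \<Longrightarrow> vert z = vert x"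
proof -
  have "vert x \<in> broadcasting_verts G f" using pos by (simp add: broadcasting_verts_def)
  then obtain w where w: "w \<in> pverts G" "heard G f w = {vert x}"
    using irr unfolding irredundant_iff by blast
  then have "graph_dist G w (vert x) \<le> f (vert x)" by (auto simp: heard_def)
  with w obtain y where "w = vert y" "\<bar>y - x\<bar> \<le> int (f (vert x))" using near_lift by blast
  with w show thesis by (intro that[of y]) (auto simp: heard_vert)
qed

text \<open>Whatever \<open>x\<close> reaches is reached by \<open>x - 1\<close> or
  \<open>x + 1\<close>, which leaves \<open>x\<close> without a private neighbour.\<close>

lemma no_three_consecutive_ones:
  assumes irr: "irredundant_broadcast G f" and "f (vert x) = 1"
  shows "\<not> (f (vert (x - 1)) = 1 \<and> f (vert (x + 1)) = 1)"
proof
  assume nb: "f (vert (x - 1)) = 1 \<and> f (vert (x + 1)) = 1"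
  obtain y where y: "\<bar>y - x\<bar> \<le> 1" "\<And>z. z \<in> hears f y \<Longrightarrow> vert z = vert x"
    using private_lift[OF irr, of x] assms by auto
  have "x - 1 \<in> hears f y \<or> x + 1 \<in> hears f y" using y(1) nb by (auto simp: hears_def)
  then have "vert (x - 1) = vert x \<or> vert (x + 1) = vert x" using y(2) by blast
  then show False using vert_inj_near[of "x - 1" x] vert_inj_near[of "x + 1" x] n_ge_3 by auto
qed

text \<open>Extracts from maximality all that the charging argument needs; \<open>s\<close> is the
  side of \<open>v\<close> on which \<open>u\<close> lies.\<close>

lemma undominated_lift:
  assumes max: "maximal_irredundant_broadcast G f" and u: "hears f u = {}"
  obtains v s where "s = 1 \<or> s = - 1" "f (vert v) > 0" "u = v + s * (int (f (vert v)) + 1)"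
    "hears f (v - s * (int (f (vert v)) + 1)) \<noteq> {}" "f (vert v) = 1 \<Longrightarrow> f (vert (v - s)) = 1"
proof -
  have irr: "irredundant_broadcast G f" using max by (simp add: maximal_irredundant_broadcast_def)
  have hu: "heard G f (vert u) = {}" by (simp add: heard_vert u)
  have "vert (u + 1) \<noteq> vert u" using vert_inj_near[of "u + 1" u] n_ge_3 by auto
  then obtain v\<^sub>0 where v\<^sub>0: "v\<^sub>0 \<in> broadcasting_verts G f" and
    crit: "\<And>y. \<lbrakk>y \<in> pverts G; heard G f y = {v\<^sub>0}; graph_dist G y v\<^sub>0 = f v\<^sub>0 \<or> f v\<^sub>0 = 1\<rbrakk>
      \<Longrightarrow> graph_dist G y (vert u) \<le> 1"
    using maximal_irredundant_undominated_vertex[OF max _ hu, of "vert (u + 1)"] by auto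
  obtain y where y: "y \<in> pverts G" "heard G f y = {v\<^sub>0}" "graph_dist G y v\<^sub>0 = f v\<^sub>0 \<or> f v\<^sub>0 = 1"
    using irr v\<^sub>0 unfolding irredundant_iff by blast
  obtain y' where y': "y = vert y'" "\<bar>y' - u\<bar> \<le> 1"
    using near_lift[OF y(1) crit[OF y]] by auto
  have "v\<^sub>0 \<in> vert ` hears f y'" using y(2) heard_vert y'(1) by auto
  then obtain v where v: "v\<^sub>0 = vert v" "v \<in> hears f y'" by blast
  define k where "k = f (vert v)"
  have k: "k > 0" "\<bar>y' - v\<bar> \<le> int k" using v(2) by (auto simp: hears_def k_def)
  have far: "int (f (vert x)) < \<bar>u - x\<bar>" if "f (vert x) > 0" for x
    using that u not_le unfolding hears_def by blast
  have uv: "int k < \<bar>u - v\<bar>" using far[of v] k by (simp add: k_def)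
  define s :: int where "s = (if u > v then 1 else - 1)"
  have s: "s = 1 \<or> s = - 1" by (simp add: s_def)
  \<comment> \<open>\<open>y'\<close> is within \<open>k\<close> of \<open>v\<close> and within 1 of
    \<open>u\<close>, which \<open>v\<close> does not reach; so the gap is exactly
    \<open>k + 1\<close>.\<close>
  have us: "u = v + s * (int k + 1)" using uv k y'(2) by (auto simp: s_def)
  have duv: "graph_dist G (vert u) (vert v) = f (vert v) + 1"
  proof (rule antisym)
    show "graph_dist G (vert u) (vert v) \<le> f (vert v) + 1"
      using dist_le_lift_dist[of u v] us s by (auto simp: k_def)
    have "vert v \<notin> heard G f (vert u)" using hu by simp
    then show "f (vert v) + 1 \<le> graph_dist G (vert u) (vert v)"
      using v\<^sub>0 v by (auto simp: heard_def)
  qed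
  obtain w v\<^sub>1 where w: "w \<in> pverts G" "v\<^sub>1 \<noteq> vert v" "heard G f w = {v\<^sub>1}"
    "graph_dist G w v\<^sub>1 = f v\<^sub>1 \<or> f v\<^sub>1 = 1" "graph_dist G w (vert v) = f (vert v) + 1"
    using maximal_irredundant_undominated_beyond_boundary[OF max _ hu _ duv] v\<^sub>0 v by auto
  obtain w' where w': "w = vert w'" "\<bar>w' - v\<bar> \<le> int k + 1"
  proof -
    have "graph_dist G w (vert v) \<le> k + 1" using w(5) by (simp add: k_def)
    from near_lift[OF w(1) this] show thesis using that by (metis of_nat_1 of_nat_add)
  qed
  have "\<bar>w' - v\<bar> > int k"
    using dist_le_lift_dist[of w' v] w(5) w'(1) by (auto simp: k_def)
  moreover have "w' \<noteq> u" using w(3) w'(1) hu by auto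
  \<comment> \<open>Only two integers lie at distance \<open>k + 1\<close> from \<open>v\<close>,
    and \<open>u\<close> is ruled out because it hears nothing.\<close>
  ultimately have w's: "w' = v - s * (int k + 1)" using w'(2) us s by auto
  have hw: "vert ` hears f w' = {v\<^sub>1}" using w(3) w'(1) by (simp add: heard_vert)
  have "f (vert (v - s)) = 1" if k1: "k = 1"
  proof -
    \<comment> \<open>Every witness for \<open>v\<close> is within 1 of \<open>u\<close>, whereas
      \<open>v\<close> is at distance 2 from it. So \<open>v\<close> hears a second vertex
      \<open>x\<close>.\<close>
    have "heard G f (vert v) \<noteq> {vert v}"
    proof
      assume "heard G f (vert v) = {vert v}"
      then have "graph_dist G (vert v) (vert u) \<le> 1" using crit[of "vert v"] k1 v(1) by (simp add: k_def)
      then show False using duv dist_commute[of "vert u" "vert v"] k1 by (simp add: k_def)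
    qed
    moreover have "v \<in> hears f v" using k by (simp add: hears_def k_def)
    ultimately obtain x where x: "x \<in> hears f v" "vert x \<noteq> vert v" unfolding heard_vert by blast
    define m where "m = int (f (vert x))"
    have m: "m > 0" "\<bar>v - x\<bar> \<le> m" using x(1) by (auto simp: hears_def m_def)
    obtain z where z: "\<bar>z - x\<bar> \<le> m" "\<And>t. t \<in> hears f z \<Longrightarrow> vert t = vert x"
      using private_lift[OF irr, of x] m(1) by (auto simp: m_def)
    have "v \<notin> hears f z" using z(2) x(2) by metis
    then have "\<bar>z - v\<bar> > 1" using k1 by (auto simp: hears_def k_def)
    moreover have "\<bar>u - x\<bar> > m" using far[of x] m(1) by (simp add: m_def)
    \<comment> \<open>The interval reached by \<open>x\<close> contains \<open>v\<close>, misses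
      \<open>u\<close>, and contains \<open>z\<close> outside the reach of \<open>v\<close>; hence
      it extends past \<open>v\<close> as far as \<open>w'\<close>.\<close>
    ultimately have near: "\<bar>w' - x\<bar> \<le> m" "\<bar>v + s - x\<bar> \<le> m + 1"
      using s us w's m z(1) k1 by auto
    then have "x \<in> hears f w'" using m(1) by (simp add: hears_def m_def)
    then have "vert x = v\<^sub>1" using hw by blast
    then have "\<bar>w' - x\<bar> \<ge> m \<or> m = 1"
      using w(4) dist_le_lift_dist[of w' x] w'(1) by (auto simp: m_def)
    \<comment> \<open>The interval contains \<open>w' = v - 2 * s\<close> and ends by
      \<open>v + s\<close>. If \<open>w'\<close> is an end point, then \<open>2 * m \<le> 3\<close>;
      so \<open>m = 1\<close> either way, and \<open>x\<close> is midway between \<open>w'\<close>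
      and \<open>v\<close>.\<close>
    then have "x = v - s \<and> m = 1"
      using near s us w's m k1 \<open>\<bar>u - x\<bar> > m\<close> by auto
    then show ?thesis by (auto simp: m_def)
  qed
  then show thesis
    using that[of s v] s k(1) us hw w's by (auto simp: k_def)
qed

section \<open>Lower bounds on the cost by charging\<close>

text \<open>A union bound. \<open>D\<close> depends on the vertex and not on the lift, so the
  charges sum over the finite vertex set.\<close>

lemma offset_cover_bound:
  assumes card: "\<And>v. v \<in> pverts G \<Longrightarrow> finite (D v) \<and> card (D v) \<le> 3 * f v"
    and cover: "\<And>y. \<exists>x. y - x \<in> D (vert x)"
  shows "n \<le> 3 * broadcast_cost G f"
proof -
  let ?S = "\<lambda>v. (\<lambda>i. vert (int v + i)) ` D v"
  have "y \<in> (\<Union>v\<in>pverts G. ?S v)" if y: "y \<in> pverts G" for y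
  proof -
    obtain x where x: "int y - x \<in> D (vert x)" using cover by blast
    obtain j where "int (vert x) = x + j * int n" using int_vert by blast
    then have "int (vert x) + (int y - x) = int y + j * int n" by simp
    then have "vert (int (vert x) + (int y - x)) = y" using vert_of_nat[OF y] vert_shift by metis
    then show ?thesis using x by (intro UN_I[of "vert x"]) (auto intro!: image_eqI[of _ _ "int y - x"])
  qed
  then have sub: "pverts G \<subseteq> (\<Union>v\<in>pverts G. ?S v)" by blast
  have "n = card (pverts G)" by (simp add: pverts_cycle)
  also have "\<dots> \<le> card (\<Union>v\<in>pverts G. ?S v)"
    using sub card finite_verts by (intro card_mono) auto
  also have "\<dots> \<le> (\<Sum>v\<in>pverts G. card (?S v))" by (rule card_UN_le[OF finite_verts])
  also have "\<dots> \<le> (\<Sum>v\<in>pverts G. 3 * f v)"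
    using card by (intro sum_mono) (blast intro: order_trans card_image_le)
  finally show ?thesis by (simp add: broadcast_cost_def sum_distrib_left)
qed

lemma dominating_cost_bound:
  assumes "dominating_broadcast G f"
  shows "n \<le> 3 * broadcast_cost G f"
\<comment> \<open>A silent vertex needs the empty set, as the interval would be \<open>{0}\<close>
  and exceed \<open>3 * 0\<close>.\<close>
proof (rule offset_cover_bound[where D = "\<lambda>v. if f v = 0 then {} else {- int (f v)..int (f v)}"])
  fix y
  have "heard G f (vert y) \<noteq> {}" using assms by (simp add: dominating_iff)
  then obtain x where "x \<in> hears f y" by (auto simp: heard_vert)
  then show "\<exists>x. y - x \<in> (if f (vert x) = 0 then {} else {- int (f (vert x))..int (f (vert x))})"
    by (intro exI[of _ x]) (auto simp: hears_def)
qed auto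

lemma maximal_irredundant_cost_bound:
  assumes max: "maximal_irredundant_broadcast G f"
  shows "n \<le> 3 * broadcast_cost G f"
proof -
  have irr: "irredundant_broadcast G f" using max by (simp add: maximal_irredundant_broadcast_def)
  \<comment> \<open>\<open>D v\<close> is the set of offsets from \<open>v\<close> of the at most \<open>3 f(v)\<close> vertices charged to \<open>v\<close>. Two
    adjacent vertices of value \<open>1\<close> are each charged with three vertices on their own side.\<close>
  define D :: "nat \<Rightarrow> int set" where "D v =
    (if f v = 0 then {}
     else if f v = 1 then
       (if f (vert (int v - 1)) = 1 then {0..2}
        else if f (vert (int v + 1)) = 1 then {- 2..0} else {- 1..1})
     else if hears f (int v + (int (f v) + 1)) = {} then {- int (f v)..int (f v) + 1}
     else {- int (f v) - 1..int (f v)})" for v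
  have hears_shift: "hears f (y + j * int n) = {} \<longleftrightarrow> hears f y = {}" for y j
    using heard_vert[of f y] heard_vert[of f "y + j * int n"] by (metis image_is_empty vert_shift)
  \<comment> \<open>\<open>D\<close> is defined through the canonical lift \<open>int v\<close>; by
    periodicity the same description holds at every lift.\<close>
  have D_vert: "D (vert x) =
    (if f (vert x) = 0 then {}
     else if f (vert x) = 1 then
       (if f (vert (x - 1)) = 1 then {0..2}
        else if f (vert (x + 1)) = 1 then {- 2..0} else {- 1..1})
     else if hears f (x + (int (f (vert x)) + 1)) = {} then {- int (f (vert x))..int (f (vert x)) + 1}
     else {- int (f (vert x)) - 1..int (f (vert x))})" for x
  proof -
    obtain j where j: "int (vert x) = x + j * int n" using int_vert by blast
    have "int (vert x) + i = (x + i) + j * int n" for i using j by simp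
    then have "vert (int (vert x) + i) = vert (x + i)"
      "hears f (int (vert x) + i) = {} \<longleftrightarrow> hears f (x + i) = {}" for i
      using hears_shift vert_shift by metis+
    from this(1)[of 1] this(1)[of "- 1"] this(2) show ?thesis by (simp add: D_def)
  qed
  show ?thesis
  proof (rule offset_cover_bound)
    show "finite (D v) \<and> card (D v) \<le> 3 * f v" for v by (auto simp: D_def)
    show "\<exists>x. y - x \<in> D (vert x)" for y
    proof (cases "hears f y = {}")
      case True
      obtain v s where vs: "s = 1 \<or> s = - 1" "f (vert v) > 0" "y = v + s * (int (f (vert v)) + 1)"
        "hears f (v - s * (int (f (vert v)) + 1)) \<noteq> {}" "f (vert v) = 1 \<Longrightarrow> f (vert (v - s)) = 1"
        using undominated_lift[OF max True] by metis
      have "y - v \<in> D (vert v)"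
      proof (cases "f (vert v) = 1")
        case f1: True
        \<comment> \<open>For \<open>s = - 1\<close> the branch \<open>{- 2..0}\<close> is reached
          only if \<open>vert (v - 1)\<close> does not have value 1, which holds because
          \<open>vert (v + 1)\<close> does.\<close>
        then show ?thesis
          using vs no_three_consecutive_ones[OF irr f1] by (auto simp: D_vert)
      next
        case False
        \<comment> \<open>With \<open>u\<close> on the left, the dominated vertex is on the right,
          which selects the branch extended to the left. For \<open>s = 1\<close> the test in
          \<open>D\<close> is made at \<open>y\<close> itself.\<close>
        have "hears f (v + (int (f (vert v)) + 1)) \<noteq> {}" if "s = - 1"
          using vs(4) that by (simp add: algebra_simps)
        then show ?thesis using False vs(1-3) True by (auto simp: D_vert)
      qed
      then show ?thesis ..
    next
      case False
      then obtain x where x: "f (vert x) > 0" "\<bar>y - x\<bar> \<le> int (f (vert x))" by (auto simp: hears_def)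
      show ?thesis
      proof (cases "f (vert x) = 1")
        case f1: True
        \<comment> \<open>A neighbour \<open>y\<close> omitted by a lopsided
          \<open>D (vert x)\<close> itself has value 1, and is charged to itself through the offset
          0.\<close>
        consider "y - x \<in> D (vert x)" | "f (vert (x - 1)) = 1" "y = x - 1"
          | "f (vert (x + 1)) = 1" "y = x + 1"
        proof -
          have "y - x \<in> D (vert x) \<or> f (vert (x - 1)) = 1 \<and> y = x - 1 \<or>
              f (vert (x + 1)) = 1 \<and> y = x + 1"
            using x f1 by (auto simp: D_vert)
          then show thesis using that by blast
        qed
        then show ?thesis
        proof cases
          case 1
          then show ?thesis ..
        next
          case 2
          then have "y - (x - 1) \<in> D (vert (x - 1))"
            using f1 by (auto simp: D_vert)
          then show ?thesis ..
        next
          case 3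
          then have "y - (x + 1) \<in> D (vert (x + 1))"
            using f1 by (auto simp: D_vert)
          then show ?thesis ..
        qed
      next
        case False
        then have "y - x \<in> D (vert x)" using x by (auto simp: D_vert)
        then show ?thesis ..
      qed
    qed
  qed
qed

section \<open>Attaining the bound and the values of both parameters\<close>

lemma dominating_every_third:
  defines "f \<equiv> restrict (\<lambda>v. if 3 dvd v then 1 else 0) (pverts G)"
  shows "dominating_broadcast G f" "broadcast_cost G f = (n + 2) div 3"
proof -
  have ecc: "1 \<le> eccentricity G v" if "v \<in> pverts G" for v
  proof -
    obtain w where "w \<in> pverts G" "w \<noteq> v"
      using n_ge_3 that by (intro that[of "if v = 0 then 1 else 0"]) (auto simp: pverts_cycle)
    then show ?thesis
      using dist_le_eccentricity[of w v] dist_eq_0_iff[of w v] that by simp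
  qed
  have f1: "f (vert x) = 1" if "3 dvd vert x" for x
    using that by (simp add: f_def)
  have "heard G f v \<noteq> {}" if v: "v \<in> pverts G" for v
  proof -
    have vn: "v < n" using v by (simp add: pverts_cycle)
    have vert_eq: "vert (int w) = w" if "w < n" for w using that by (simp add: vert_of_nat pverts_cycle)
    have "\<exists>x. 3 dvd vert x \<and> \<bar>int v - x\<bar> \<le> 1"
    proof -
      consider "3 dvd v" | "3 dvd v - 1" "v \<ge> 1" | "3 dvd v + 1"
      proof -
        have "3 dvd v \<or> 3 dvd v - 1 \<and> v \<ge> 1 \<or> 3 dvd v + 1" by presburger
        then show thesis using that by blast
      qed
      then show ?thesis
      proof cases
        case 1
        then show ?thesis using vert_eq[OF vn] by (intro exI[of _ "int v"]) auto
      next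
        case 2
        then show ?thesis using vert_eq[of "v - 1"] vn by (intro exI[of _ "int (v - 1)"]) auto
      next
        case 3
        \<comment> \<open>If \<open>v + 1 = n\<close>, the lift \<open>n\<close> lies over vertex 0,
          which also has value 1.\<close>
        then have "3 dvd vert (int (v + 1))"
          using vn vert_eq[of "v + 1"] by (cases "v + 1 = n") (auto simp: vert_def)
        then show ?thesis by (intro exI[of _ "int (v + 1)"]) auto
      qed
    qed
    then obtain x where "3 dvd vert x" "\<bar>int v - x\<bar> \<le> 1" by blast
    then have "x \<in> hears f (int v)" using f1[of x] by (simp add: hears_def)
    then show ?thesis using heard_vert[of f "int v"] vert_of_nat[OF v] by auto
  qed
  then show "dominating_broadcast G f"
    using ecc by (auto simp: dominating_iff broadcast_iff f_def)
  have "(\<Sum>v\<in>{0..<m}. if 3 dvd v then 1 else 0) = (m + 2) div 3" for m :: nat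
  proof (induction m)
    case (Suc m)
    have "(Suc m + 2) div 3 = (m + 2) div 3 + (if 3 dvd m then 1 else 0)" by presburger
    then show ?case using Suc by simp
  qed simp
  then show "broadcast_cost G f = (n + 2) div 3"
    by (simp add: broadcast_cost_def f_def pverts_cycle)
qed

lemma domination_number: "\<gamma>\<^sub>b G = (n + 2) div 3"
  unfolding broadcast_domination_number_def
proof (rule cInf_eq_minimum)
  show "(n + 2) div 3 \<in> {broadcast_cost G f | f. dominating_broadcast G f}"
    by (intro CollectI exI[of _ "restrict (\<lambda>v. if 3 dvd v then 1 else 0) (pverts G)"])
      (simp add: dominating_every_third)
  fix c assume "c \<in> {broadcast_cost G f | f. dominating_broadcast G f}"
  then have "n \<le> 3 * c" using dominating_cost_bound by blast
  then show "(n + 2) div 3 \<le> c" by simp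
qed

lemma irredundance_number: "ir\<^sub>b G = (n + 2) div 3"
  unfolding broadcast_irredundance_number_def
proof (rule cInf_eq_minimum)
  show "(n + 2) div 3 \<in> {broadcast_cost G f | f. maximal_irredundant_broadcast G f}"
    using exists_maximal_irredundant_of_domination_cost[OF dominating_every_third(1)]
    unfolding domination_number by force
  fix c assume "c \<in> {broadcast_cost G f | f. maximal_irredundant_broadcast G f}"
  then have "n \<le> 3 * c" using maximal_irredundant_cost_bound by blast
  then show "(n + 2) div 3 \<le> c" by simp
qed

end

theorem theorem3p13:
  fixes n :: nat
  assumes "n \<ge> 3"
  shows "ir\<^sub>b (cycle_graph n) = \<gamma>\<^sub>b (cycle_graph n) \<and>
         int (\<gamma>\<^sub>b (cycle_graph n)) = \<lceil>real n / 3\<rceil>"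
proof -
  interpret cycle n using assms by unfold_locales
  have "\<lceil>real n / 3\<rceil> = int ((n + 2) div 3)"
  proof (rule ceiling_unique)
    have "n \<le> 3 * ((n + 2) div 3)" "3 * ((n + 2) div 3) \<le> n + 2" by presburger+
    then have "real n \<le> 3 * real ((n + 2) div 3)" "3 * real ((n + 2) div 3) \<le> real n + 2"
      by linarith+
    then show "of_int (int ((n + 2) div 3)) - 1 < real n / 3"
      "real n / 3 \<le> of_int (int ((n + 2) div 3))" by simp_all
  qed
  then show ?thesis by (simp add: domination_number irredundance_number)
qed

end
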